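(* For $n\ge1$ let $L_n$ be the graph with $n+1$ vertices $v_0,v_1,\dots,v_n$ and $n$ edges $[v_0,v_1],[v_1,v_2],\dots,[v_{n-1},v_n]$, and set $p_n=P(L_n)$. Then, as power series in $z$, $$\sum_{n\ge1}p_nz^n=\frac{12z-z^2}{z^2-12z+16}=\frac{16}{z^2-12z+16}-1.$$ In particular, $h(L_n)\sim\log r$ as $n\to\infty$, where $$r=\frac{3+\sqrt5}{8}<\frac34.$$
   Context: Let $\Gamma$ be a finite graph without loops or multiple edges, with vertex set $V(\Gamma)$, edge set $E(\Gamma)$, and $N_\Gamma=|E(\Gamma)|$. Let $I_\Gamma\subset V(\Gamma)\times E(\Gamma)$ be the set of pairs $(v,e)$ with $v$ an endpoint of $e$ (so $|I_\Gamma|=2N_\Gamma$). An orientation prescription is a function $\omega:I_\Gamma\to\{\pm1\}$; it orients each edge of the barycentric subdivision of $\Gamma$ (whose edges join a vertex $v$ to the midpoint $b_e$ of an incident edge $e$): the edge is oriented $b_e\to v$ if $\omega(v,e)=1$, and $v\to b_e$ if $\omega(v,e)=-1$. The prescription $\omega$ is a combinatorial flow if every vertex $v\in V(\Gamma)$ has at most one outgoing edge and every midpoint $b_e$ has at most one incoming edge; equivalently, for each $v$ there is at most one $e$ with $\omega(v,e)=-1$, and for each $e$ there is at most one $v$ with $\omega(v,e)=-1$. Let $P(\Gamma)$ be the probability that a uniformly random orientation prescription is a combinatorial flow, i.e. $P(\Gamma)=4^{-N_\Gamma}\cdot\#\{\text{combinatorial flows on }\Gamma\}$. Define $h(\Gamma)=\frac{\log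 P(\Gamma)}{N_\Gamma}$ if $E(\Gamma)\ne\emptyset$ and $h(\Gamma)=0$ otherwise. The notation $a_n\sim a$ for a nonzero constant $a$ means $a_n/a\to1$, i.e. $a_n\to a$. *)

theory Defs
  imports
    "HOL-Probability.Probability_Mass_Function"
    "HOL-Library.FuncSet"
    "HOL-Library.Landau_Symbols"
    "HOL-Computational_Algebra.Formal_Power_Series"
begin

section \<open>Finite simple graphs\<close>

record 'a graph =
  verts :: "'a set"
  edges :: "'a set set"

definition fin_simple_graph :: "'a graph \<Rightarrow> bool" where
  "fin_simple_graph G \<longleftrightarrow>
     finite (verts G) \<and> (\<forall>e\<in>edges G. e \<subseteq> verts G \<and> card e = 2)"

definition incidences :: "'a graph \<Rightarrow> ('a \<times> 'a set) set" where
  "incidences G = {(v, e). v \<in> verts G \<and> e \<in> edges G \<and> v \<in> e}"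


section \<open>Orientation prescriptions and combinatorial flows\<close>

text \<open>Prescriptions are extensional functions, so that each one is counted exactly once.\<close>

definition prescriptions :: "'a graph \<Rightarrow> ('a \<times> 'a set \<Rightarrow> int) set" where
  "prescriptions G = incidences G \<rightarrow>\<^sub>E {1, -1}"

text \<open>Nodes of the barycentric subdivision: \<open>Mid e\<close> is the midpoint of the edge \<open>e\<close>.\<close>

datatype 'a node = Vertex 'a | Mid "'a set"

definition arcs_of :: "'a graph \<Rightarrow> ('a \<times> 'a set \<Rightarrow> int) \<Rightarrow> ('a node \<times> 'a node) set" where
  "arcs_of G \<omega> =
     {(Mid e, Vertex v) | v e. (v, e) \<in> incidences G \<and> \<omega> (v, e) = 1} \<union>
     {(Vertex v, Mid e) | v e. (v, e) \<in> incidences G \<and> \<omega> (v, e) = -1}"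

definition combinatorial_flow :: "'a graph \<Rightarrow> ('a \<times> 'a set \<Rightarrow> int) \<Rightarrow> bool" where
  "combinatorial_flow G \<omega> \<longleftrightarrow>
     \<omega> \<in> prescriptions G \<and>
     (\<forall>v\<in>verts G. \<exists>\<^sub>\<le>\<^sub>1 y. (Vertex v, y) \<in> arcs_of G \<omega>) \<and>
     (\<forall>e\<in>edges G. \<exists>\<^sub>\<le>\<^sub>1 x. (x, Mid e) \<in> arcs_of G \<omega>)"

lemma combinatorial_flow_iff:
  "combinatorial_flow G \<omega> \<longleftrightarrow>
     \<omega> \<in> prescriptions G \<and>
     (\<forall>v\<in>verts G. \<exists>\<^sub>\<le>\<^sub>1 e. (v, e) \<in> incidences G \<and> \<omega> (v, e) = -1) \<and>
     (\<forall>e\<in>edges G. \<exists>\<^sub>\<le>\<^sub>1 v. (v, e) \<in> incidences G \<and> \<omega> (v, e) = -1)"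
proof -
  have "(\<exists>\<^sub>\<le>\<^sub>1 y. (Vertex v, y) \<in> arcs_of G \<omega>) \<longleftrightarrow>
        (\<exists>\<^sub>\<le>\<^sub>1 e. (v, e) \<in> incidences G \<and> \<omega> (v, e) = -1)" for v
    unfolding arcs_of_def Uniq_def by auto
  moreover have "(\<exists>\<^sub>\<le>\<^sub>1 x. (x, Mid e) \<in> arcs_of G \<omega>) \<longleftrightarrow>
        (\<exists>\<^sub>\<le>\<^sub>1 v. (v, e) \<in> incidences G \<and> \<omega> (v, e) = -1)" for e
    unfolding arcs_of_def Uniq_def by auto
  ultimately show ?thesis by (simp add: combinatorial_flow_def)
qed

definition flow_prob :: "'a graph \<Rightarrow> real" where
  "flow_prob G =
     measure_pmf.prob (pmf_of_set (prescriptions G)) {\<omega>. combinatorial_flow G \<omega>}"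

definition flow_entropy :: "'a graph \<Rightarrow> real" where
  "flow_entropy G =
     (if edges G \<noteq> {} then ln (flow_prob G) / real (card (edges G)) else 0)"

lemma fin_simple_graph_finite_edges:
  assumes "fin_simple_graph G" shows "finite (edges G)"
proof (rule finite_subset)
  show "edges G \<subseteq> Pow (verts G)" using assms by (auto simp: fin_simple_graph_def)
  show "finite (Pow (verts G))" using assms by (simp add: fin_simple_graph_def)
qed

lemma card_incidences:
  assumes G: "fin_simple_graph G"
  shows "finite (incidences G)" and "card (incidences G) = 2 * card (edges G)"
proof -
  have eq: "incidences G = (\<lambda>(e, v). (v, e)) ` (SIGMA e:edges G. e)"
    using G unfolding fin_simple_graph_def incidences_def by force
  have fe: "\<forall>e\<in>edges G. finite e"
    using G unfolding fin_simple_graph_def by (metis card.infinite zero_neq_numeral)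
  note fE = fin_simple_graph_finite_edges[OF G]
  show "finite (incidences G)" unfolding eq using fe fE by auto
  have "card (incidences G) = card (SIGMA e:edges G. e)"
    unfolding eq by (rule card_image) (auto simp: inj_on_def)
  also have "\<dots> = (\<Sum>e\<in>edges G. card e)"
    using fE fe by simp
  also have "\<dots> = 2 * card (edges G)"
    using G by (simp add: fin_simple_graph_def)
  finally show "card (incidences G) = 2 * card (edges G)" .
qed

lemma flow_prob_eq:
  assumes G: "fin_simple_graph G"
  shows "flow_prob G = real (card {\<omega>. combinatorial_flow G \<omega>}) / 4 ^ card (edges G)"
proof -
  note fI = card_incidences[OF G]
  have fin: "finite (prescriptions G)"
    unfolding prescriptions_def by (intro finite_PiE fI) auto
  have ne: "prescriptions G \<noteq> {}"
    unfolding prescriptions_def by (simp add: PiE_eq_empty_iff)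
  have "card (prescriptions G) = 2 ^ card (incidences G)"
    unfolding prescriptions_def by (simp add: card_PiE fI(1) numeral_2_eq_2)
  then have card: "card (prescriptions G) = 4 ^ card (edges G)"
    by (simp add: fI(2) power_mult)
  have "prescriptions G \<inter> {\<omega>. combinatorial_flow G \<omega>} = {\<omega>. combinatorial_flow G \<omega>}"
    by (auto simp: combinatorial_flow_def)
  then show ?thesis
    unfolding flow_prob_def by (simp add: measure_pmf_of_set[OF ne fin] card)
qed


section \<open>The linear graphs\<close>

definition path_graph :: "nat \<Rightarrow> nat graph" where
  "path_graph n = \<lparr>verts = {0..n}, edges = {{i, i + 1} | i. i < n}\<rparr>"

lemma fin_simple_graph_path_graph: "fin_simple_graph (path_graph n)"
  by (auto simp: fin_simple_graph_def path_graph_def)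

lemma card_edges_path_graph: "card (edges (path_graph n)) = n"
proof -
  have "edges (path_graph n) = (\<lambda>i. {i, i + 1}) ` {..<n}"
    by (auto simp: path_graph_def)
  moreover have "inj_on (\<lambda>i. {i, i + 1}) {..<n}"
    by (auto simp: inj_on_def doubleton_eq_iff)
  ultimately show ?thesis by (simp add: card_image)
qed

end

theory Submission
  imports Defs "HOL-Number_Theory.Fib"
begin

text \<open>The barycentric subdivision of the path with n edges is a path with 2n edges, and the
  combinatorial flows are its matchings: the edges oriented away from a vertex of the graph may
  not be adjacent. Numbering the edges along the path turns matchings into subsets of
  \<open>{..<2n}\<close> without consecutive elements, of which there are \<open>fib (2n + 2)\<close>. The
  recurrence \<open>fib (k + 4) + fib k = 3 fib (k + 2)\<close> gives the denominator of the generating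
  function, and Binet's formula gives the growth rate \<open>\<phi>\<^sup>2 / 4 = (3 + sqrt 5) / 8\<close>.\<close>

section \<open>Sets without consecutive elements and Fibonacci numbers\<close>

definition sparse_subsets :: "nat \<Rightarrow> nat set set" where
  "sparse_subsets m = {S. S \<subseteq> {..<m} \<and> (\<forall>k\<in>S. Suc k \<notin> S)}"

lemma finite_sparse_subsets: "finite (sparse_subsets m)"
  by (rule finite_subset[of _ "Pow {..<m}"]) (auto simp: sparse_subsets_def)

text \<open>Split by whether the largest candidate \<open>Suc m\<close> occurs. If it does,
  \<open>m\<close> is excluded, so the remaining elements lie below \<open>m\<close>.\<close>

lemma sparse_subsets_Suc_Suc:
  "sparse_subsets (Suc (Suc m)) =
     sparse_subsets (Suc m) \<union> insert (Suc m) ` sparse_subsets m"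
proof (intro equalityI subsetI)
  fix S assume S: "S \<in> sparse_subsets (Suc (Suc m))"
  show "S \<in> sparse_subsets (Suc m) \<union> insert (Suc m) ` sparse_subsets m"
  proof (cases "Suc m \<in> S")
    case True
    then have "m \<notin> S"
      using S by (auto simp: sparse_subsets_def)
    then have "S - {Suc m} \<in> sparse_subsets m"
      using S by (auto simp: sparse_subsets_def less_Suc_eq)
    moreover have "S = insert (Suc m) (S - {Suc m})"
      using True by auto
    ultimately show ?thesis by blast
  next
    case False
    then show ?thesis
      using S by (auto simp: sparse_subsets_def less_Suc_eq)
  qed
next
  fix S assume "S \<in> sparse_subsets (Suc m) \<union> insert (Suc m) ` sparse_subsets m"
  then show "S \<in> sparse_subsets (Suc (Suc m))"
    by (auto simp: sparse_subsets_def subset_iff less_SucI)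
qed

text \<open>The splitting by the largest candidate is disjoint, which gives the Fibonacci
  recurrence. The index is shifted by 2 because the counts start with 1 and 2.\<close>

lemma card_sparse_subsets: "card (sparse_subsets m) = fib (m + 2)"
proof (induction m rule: fib.induct)
  case 1
  have "sparse_subsets 0 = {{}}"
    by (auto simp: sparse_subsets_def)
  then show ?case by simp
next
  case 2
  have "sparse_subsets (Suc 0) = {{}, {0}}"
  proof (intro equalityI subsetI)
    fix S assume "S \<in> sparse_subsets (Suc 0)"
    then have "S \<subseteq> {0}"
      by (simp add: sparse_subsets_def lessThan_Suc)
    then show "S \<in> {{}, {0}}"
      by (simp add: subset_singleton_iff)
  qed (auto simp: sparse_subsets_def)
  then show ?case by (simp add: numeral_eq_Suc)
next
  case (3 m)
  have "inj_on (insert (Suc m)) (sparse_subsets m)"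
  proof (rule inj_onI)
    fix S T assume ST: "S \<in> sparse_subsets m" "T \<in> sparse_subsets m"
      "insert (Suc m) S = insert (Suc m) T"
    then have "Suc m \<notin> S" "Suc m \<notin> T"
      by (auto simp: sparse_subsets_def)
    with ST(3) show "S = T"
      by (simp add: insert_ident)
  qed
  moreover have "sparse_subsets (Suc m) \<inter> insert (Suc m) ` sparse_subsets m = {}"
    by (auto simp: sparse_subsets_def)
  ultimately have "card (sparse_subsets (Suc (Suc m))) =
      card (sparse_subsets (Suc m)) + card (sparse_subsets m)"
    by (simp add: sparse_subsets_Suc_Suc card_Un_disjoint finite_sparse_subsets card_image)
  with 3 show ?case by simp
qed

section \<open>Numbering half-edges and encoding flows as sparse sets\<close>

definition path_incidence :: "nat \<Rightarrow> nat \<times> nat set" where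
  "path_incidence k = (Suc k div 2, {k div 2, k div 2 + 1})"

text \<open>Walking along the path from vertex 0, the half-edge met at position \<open>k\<close> has
  endpoint \<open>Suc k div 2\<close> and lies in edge number \<open>k div 2\<close>. These two
  quotients add up to \<open>k\<close>, so the half-edge determines its position.\<close>

lemma inj_path_incidence: "inj path_incidence"
proof (rule injI)
  fix j k assume "path_incidence j = path_incidence k"
  then have "Suc j div 2 = Suc k div 2" "j div 2 = k div 2"
    by (auto simp: path_incidence_def doubleton_eq_iff)
  moreover have "m div 2 + Suc m div 2 = m" for m :: nat
    by (induction m) simp_all
  ultimately show "j = k" by metis
qed

lemma incidences_path_graph: "incidences (path_graph n) = path_incidence ` {..<2 * n}"
proof (intro equalityI subsetI)
  fix x assume "x \<in> incidences (path_graph n)"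
  then obtain v i where x: "x = (v, {i, i + 1})" and i: "i < n" and "v = i \<or> v = i + 1"
    by (auto simp: incidences_def path_graph_def)
  then have "x = path_incidence (2 * i) \<or> x = path_incidence (2 * i + 1)"
    by (auto simp: path_incidence_def)
  moreover have "2 * i < 2 * n" "2 * i + 1 < 2 * n"
    using i by auto
  ultimately show "x \<in> path_incidence ` {..<2 * n}" by blast
next
  fix x assume "x \<in> path_incidence ` {..<2 * n}"
  then obtain k where k: "k < 2 * n" and x: "x = path_incidence k"
    by auto
  from k have "k div 2 < n" "Suc k div 2 \<le> n" "Suc k div 2 = k div 2 \<or> Suc k div 2 = k div 2 + 1"
    by presburger+
  then show "x \<in> incidences (path_graph n)"
    by (auto simp: x incidences_def path_graph_def path_incidence_def)
qed

text \<open>Two distinct half-edges share a vertex or a midpoint exactly when their positions are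
  consecutive. Hence the conditions at vertices and at midpoints together forbid consecutive
  positions with value -1.\<close>

lemma combinatorial_flow_path_graph_iff:
  "combinatorial_flow (path_graph n) \<omega> \<longleftrightarrow>
     \<omega> \<in> prescriptions (path_graph n) \<and>
     {k. k < 2 * n \<and> \<omega> (path_incidence k) = -1} \<in> sparse_subsets (2 * n)"
    (is "_ \<longleftrightarrow> _ \<and> ?S \<in> _")
proof -
  let ?G = "path_graph n"
  have inc: "(v, e) \<in> incidences ?G \<and> \<omega> (v, e) = -1 \<longleftrightarrow> (\<exists>k\<in>?S. (v, e) = path_incidence k)"
    for v e
    by (auto simp: incidences_path_graph)
  have "((\<forall>v\<in>verts ?G. \<exists>\<^sub>\<le>\<^sub>1 e. (v, e) \<in> incidences ?G \<and> \<omega> (v, e) = -1) \<and>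
         (\<forall>e\<in>edges ?G. \<exists>\<^sub>\<le>\<^sub>1 v. (v, e) \<in> incidences ?G \<and> \<omega> (v, e) = -1)) \<longleftrightarrow>
        (\<forall>j\<in>?S. Suc j \<notin> ?S)" (is "?V \<and> ?E \<longleftrightarrow> ?R")
  proof
    assume VE: "?V \<and> ?E"
    show ?R
    proof (intro ballI notI)
      fix j assume j: "j \<in> ?S" "Suc j \<in> ?S"
      obtain v e v' e' where p: "path_incidence j = (v, e)" "path_incidence (Suc j) = (v', e')"
        by fastforce
      have mem: "(v, e) \<in> incidences ?G \<and> \<omega> (v, e) = -1"
        "(v', e') \<in> incidences ?G \<and> \<omega> (v', e') = -1"
        unfolding inc using j p[symmetric] by blast+
      have "v \<in> verts ?G" "e \<in> edges ?G"
        using mem(1) by (auto simp: incidences_def)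
      \<comment> \<open>Positions \<open>j\<close> and \<open>Suc j\<close> meet at a midpoint for
        even \<open>j\<close> and at a vertex for odd \<open>j\<close>.\<close>
      moreover have "v = v' \<or> e = e'"
      proof (cases "even j")
        case True
        then have "Suc j div 2 = j div 2" by presburger
        then show ?thesis using p by (auto simp: path_incidence_def)
      next
        case False
        then have "Suc (Suc j) div 2 = Suc j div 2" by presburger
        then show ?thesis using p by (auto simp: path_incidence_def)
      qed
      ultimately have "(v, e) = (v', e')"
        using VE mem unfolding Uniq_def by blast
      then have "path_incidence j = path_incidence (Suc j)"
        using p by simp
      then show False using inj_path_incidence by (auto dest: injD)
    qed
  next
    assume R: ?R
    \<comment> \<open>Positions at the same vertex are equal or adjacent, and \<open>?R\<close>
      rules out adjacency. The same argument gives \<open>E\<close> for positions on the same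
      edge.\<close>
    have V: "j = k" if "j \<in> ?S" "k \<in> ?S" "Suc j div 2 = Suc k div 2" for j k
    proof -
      from that(3) have "j = k \<or> j = Suc k \<or> k = Suc j" by presburger
      then show ?thesis using R that(1,2) by blast
    qed
    have E: "j = k" if "j \<in> ?S" "k \<in> ?S" "j div 2 = k div 2" for j k
    proof -
      from that(3) have "j = k \<or> j = Suc k \<or> k = Suc j" by presburger
      then show ?thesis using R that(1,2) by blast
    qed
    have ?V
      unfolding inc
    proof (intro ballI Uniq_I)
      fix v e e'
      assume "\<exists>k\<in>?S. (v, e) = path_incidence k" "\<exists>k\<in>?S. (v, e') = path_incidence k"
      then obtain j k where jk: "j \<in> ?S" "k \<in> ?S" "(v, e) = path_incidence j"
        "(v, e') = path_incidence k" by blast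
      have "j = k"
        by (rule V[OF jk(1,2)]) (use jk(3,4) in \<open>auto simp: path_incidence_def\<close>)
      then show "e = e'" using jk by (metis prod.inject)
    qed
    moreover have ?E
      unfolding inc
    proof (intro ballI Uniq_I)
      fix e v v'
      assume "\<exists>k\<in>?S. (v, e) = path_incidence k" "\<exists>k\<in>?S. (v', e) = path_incidence k"
      then obtain j k where jk: "j \<in> ?S" "k \<in> ?S" "(v, e) = path_incidence j"
        "(v', e) = path_incidence k" by blast
      have "j = k"
        by (rule E[OF jk(1,2)])
          (use jk(3,4) in \<open>auto simp: path_incidence_def doubleton_eq_iff\<close>)
      then show "v = v'" using jk by (metis prod.inject)
    qed
    ultimately show "?V \<and> ?E" ..
  qed
  then show ?thesis
    unfolding combinatorial_flow_iff by (auto simp: sparse_subsets_def)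
qed

lemma card_combinatorial_flows_path_graph:
  "card {\<omega>. combinatorial_flow (path_graph n) \<omega>} = fib (2 * n + 2)"
proof -
  let ?G = "path_graph n"
  let ?f = "\<lambda>\<omega> :: nat \<times> nat set \<Rightarrow> int. {k. k < 2 * n \<and> \<omega> (path_incidence k) = -1}"
  \<comment> \<open>The inverse of \<open>?f\<close> needs \<open>restrict\<close> because
    prescriptions are extensional: outside the incidences only the default value is allowed.\<close>
  let ?g = "\<lambda>S. restrict (\<lambda>x. if x \<in> path_incidence ` S then -1 else 1 :: int) (incidences ?G)"
  have fg: "?f (?g S) = S" if "S \<in> sparse_subsets (2 * n)" for S
    using that inj_path_incidence
    by (auto simp: sparse_subsets_def incidences_path_graph inj_image_mem_iff)
  have gf: "?g (?f \<omega>) = \<omega>" if "\<omega> \<in> prescriptions ?G" for \<omega>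
  proof
    fix x
    show "?g (?f \<omega>) x = \<omega> x"
    proof (cases "x \<in> incidences ?G")
      case True
      then obtain k where k: "k < 2 * n" "x = path_incidence k"
        by (auto simp: incidences_path_graph)
      have "\<omega> x = 1 \<or> \<omega> x = -1"
        using that True by (auto simp: prescriptions_def)
      with True k inj_path_incidence show ?thesis
        by (auto simp: inj_image_mem_iff)
    next
      case False
      then show ?thesis
        using that by (simp add: prescriptions_def PiE_arb[of \<omega>])
    qed
  qed
  have "bij_betw ?f {\<omega>. combinatorial_flow ?G \<omega>} (sparse_subsets (2 * n))"
  proof (rule bij_betw_byWitness[where f' = ?g])
    show "\<forall>\<omega>\<in>{\<omega>. combinatorial_flow ?G \<omega>}. ?g (?f \<omega>) = \<omega>"
      using gf by (simp add: combinatorial_flow_def)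
    show "\<forall>S\<in>sparse_subsets (2 * n). ?f (?g S) = S"
      using fg by blast
    show "?f ` {\<omega>. combinatorial_flow ?G \<omega>} \<subseteq> sparse_subsets (2 * n)"
      using combinatorial_flow_path_graph_iff by blast
    have "?g S \<in> prescriptions ?G" for S
      by (auto simp: prescriptions_def)
    then show "?g ` sparse_subsets (2 * n) \<subseteq> {\<omega>. combinatorial_flow ?G \<omega>}"
      unfolding combinatorial_flow_path_graph_iff using fg by fastforce
  qed
  from bij_betw_same_card[OF this] show ?thesis
    by (simp only: card_sparse_subsets)
qed

lemma flow_prob_path_graph: "flow_prob (path_graph n) = real (fib (2 * n + 2)) / 4 ^ n"
  by (simp only: flow_prob_eq[OF fin_simple_graph_path_graph] card_edges_path_graph
      card_combinatorial_flows_path_graph)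

section \<open>Recurrence and generating function\<close>

lemma fib_even_step: "fib (k + 4) + fib k = 3 * fib (k + 2)"
  by (simp add: numeral_eq_Suc)

text \<open>This is \<open>fib_even_step\<close> at \<open>k = 2 * n + 2\<close>, divided by
  \<open>4 ^ (n + 2)\<close>. The coefficients are kept as multiples of 1/16 to match the
  denominator of the generating function.\<close>

lemma flow_prob_path_graph_rec:
  "flow_prob (path_graph (n + 2)) - 12 * (flow_prob (path_graph (n + 1)) / 16)
     + flow_prob (path_graph n) / 16 = 0"
proof -
  have "real (fib (2 * n + 6)) + real (fib (2 * n + 2)) = 3 * real (fib (2 * n + 4))"
    using arg_cong[OF fib_even_step[of "2 * n + 2"], of real]
    by (simp only: of_nat_add of_nat_mult of_nat_numeral add.assoc numeral_plus_numeral add_num_simps)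
  moreover have "2 * (n + 2) + 2 = 2 * n + 6" "2 * (n + 1) + 2 = 2 * n + 4"
    by simp_all
  ultimately show ?thesis
    by (simp only: flow_prob_path_graph) (simp add: field_simps del: fib.simps)
qed

lemma flow_prob_path_graph_fps:
  "Abs_fps (\<lambda>n. flow_prob (path_graph n)) * (fps_X ^ 2 - 12 * fps_X + 16) = (16 :: real fps)"
proof (rule fps_ext)
  fix n :: nat
  let ?F = "Abs_fps (\<lambda>n. flow_prob (path_graph n))"
  have eq: "?F * (fps_X ^ 2 - 12 * fps_X + 16) =
      fps_X ^ 2 * ?F - fps_const 12 * (fps_X * ?F) + fps_const 16 * ?F"
    by (simp add: algebra_simps numeral_fps_const)
  have p: "flow_prob (path_graph 0) = 1" "flow_prob (path_graph (Suc 0)) = 3 / 4"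
    by (simp_all add: flow_prob_path_graph numeral_eq_Suc)
  \<comment> \<open>From degree 2 on, the coefficient is 16 times the left side of the recurrence.
    In degrees 0 and 1 it is 16 * 1 and 16 * (3/4) - 12 * 1 = 0.\<close>
  consider "n = 0" | "n = 1" | m where "n = m + 2"
    by (metis One_nat_def Suc_eq_plus1 add_2_eq_Suc' not0_implies_Suc)
  then show "fps_nth (?F * (fps_X ^ 2 - 12 * fps_X + 16)) n = fps_nth 16 n"
  proof cases
    case 3
    then show ?thesis
      using flow_prob_path_graph_rec[of m]
      by (simp only: eq) (simp add: fps_X_power_mult_nth fps_numeral_nth)
  qed (simp_all only: eq, simp_all add: fps_X_power_mult_nth fps_numeral_nth p)
qed

section \<open>Growth rate\<close>

lemma flow_entropy_path_graph_tendsto: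
  "(\<lambda>n. flow_entropy (path_graph n)) \<longlonglongrightarrow> ln ((3 + sqrt 5) / 8)"
proof -
  define \<phi> :: real where "\<phi> = (1 + sqrt 5) / 2"
  \<comment> \<open>The ratio of the flow count to the leading term of Binet's formula. It tends to
    1, and the flow probability is exactly \<open>q n * c * d ^ n\<close>.\<close>
  define q where "q n = real (fib (2 * n + 2)) / (\<phi> ^ (2 * n + 2) / sqrt 5)" for n
  have \<phi>: "\<phi> > 0" by (simp add: \<phi>_def add_pos_nonneg)
  define c where "c = \<phi>\<^sup>2 / sqrt 5"
  define d where "d = \<phi>\<^sup>2 / 4"
  have cd: "c > 0" "d > 0" using \<phi> by (simp_all add: c_def d_def)
  have r: "(3 + sqrt 5) / 8 = d"
    by (simp add: d_def \<phi>_def power2_eq_square field_simps)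
  have "filterlim (\<lambda>n::nat. 2 * n + 2) at_top at_top"
    by (rule filterlim_subseq) (simp add: strict_mono_def)
  from filterlim_compose[OF fib_asymptotics this] have q: "q \<longlonglongrightarrow> 1"
    by (simp add: q_def[abs_def] \<phi>_def)
  \<comment> \<open>The numerator converges to \<open>ln c\<close>, so division by \<open>n\<close>
    leaves only \<open>ln d\<close>.\<close>
  have lim: "(\<lambda>n. (ln (q n) + ln c) / real n + ln d) \<longlonglongrightarrow> 0 + ln d"
    by (intro tendsto_add tendsto_const real_tendsto_divide_at_top[OF
          tendsto_add[OF tendsto_ln[OF q] tendsto_const]] filterlim_real_sequentially) simp
  have entropy: "flow_entropy (path_graph n) =
      (ln (q n) + ln c) / real n + ln d" if n: "n > 0" for n
  proof -
    have qpos: "q n > 0"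
      using \<phi> by (simp add: q_def fib_neq_0_nat del: fib.simps)
    have "\<phi> ^ (2 * n + 2) = \<phi>\<^sup>2 * (\<phi>\<^sup>2) ^ n"
      by (metis power_add power_mult mult.commute)
    then have "real (fib (2 * n + 2)) / 4 ^ n = q n * c * d ^ n"
      using \<phi> by (simp add: q_def c_def d_def power_divide del: fib.simps power_Suc add_2_eq_Suc')
    then have "ln (flow_prob (path_graph n)) =
        ln (q n) + ln c + real n * ln d"
      using qpos cd by (simp only: flow_prob_path_graph ln_mult_pos ln_realpow mult_pos_pos zero_less_power)
    moreover have "edges (path_graph n) \<noteq> {}"
      using n by (auto simp: path_graph_def)
    ultimately show ?thesis
      using n by (simp add: flow_entropy_def card_edges_path_graph add_divide_distrib)
  qed
  \<comment> \<open>The formula is only claimed for \<open>n > 0\<close>: at 0 the graph has no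
    edges and the entropy is 0 by convention.\<close>
  have "\<forall>\<^sub>F n in sequentially. (ln (q n) + ln c) / real n + ln d =
      flow_entropy (path_graph n)"
    by (rule eventually_mono[OF eventually_gt_at_top[of 0]]) (simp add: entropy)
  from Lim_transform_eventually[OF lim this] show ?thesis
    by (simp add: r)
qed

theorem theorem3p2:
  shows "(Abs_fps (\<lambda>n. if n \<ge> 1 then flow_prob (path_graph n) else 0)
             = (12 * fps_X - fps_X ^ 2) / (fps_X ^ 2 - 12 * fps_X + 16 :: real fps) \<and>
          (12 * fps_X - fps_X ^ 2) / (fps_X ^ 2 - 12 * fps_X + 16 :: real fps)
             = 16 / (fps_X ^ 2 - 12 * fps_X + 16) - 1) \<and>
         (let r = (3 + sqrt 5) / 8 :: real
          in (\<lambda>n. flow_entropy (path_graph n)) \<sim>[sequentially] (\<lambda>n. ln r) \<and> r < 3 / 4)"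
proof -
  let ?D = "fps_X ^ 2 - 12 * fps_X + 16 :: real fps"
  let ?F = "Abs_fps (\<lambda>n. flow_prob (path_graph n))"
  have D: "?D \<noteq> 0"
  proof
    assume "?D = 0"
    moreover have "fps_nth ?D 0 = 16"
      by (simp add: fps_numeral_nth)
    ultimately show False
      by (simp only: fps_zero_nth)
  qed
  have div: "a / ?D = b" if "b * ?D = a" for a b :: "real fps"
    using that D by (metis nonzero_mult_div_cancel_right)
  have "flow_prob (path_graph 0) = 1"
    by (simp add: flow_prob_path_graph numeral_eq_Suc)
  \<comment> \<open>The series in the theorem starts at degree 1, so the constant term 1 of
    \<open>?F\<close> is removed.\<close>
  then have F: "Abs_fps (\<lambda>n. if n \<ge> 1 then flow_prob (path_graph n) else 0) = ?F - 1"
    by (intro fps_ext) (simp add: not_less_eq_eq)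
  have "16 / ?D = ?F"
    using flow_prob_path_graph_fps by (rule div)
  moreover have "(12 * fps_X - fps_X ^ 2) / ?D = ?F - 1"
    by (rule div) (simp add: left_diff_distrib flow_prob_path_graph_fps)
  moreover have r: "(3 + sqrt 5) / 8 < (3 / 4 :: real)"
    by (simp add: real_less_lsqrt)
  \<comment> \<open>Convergence to a constant yields asymptotic equivalence when that constant is
    nonzero; here 0 < r < 3/4 makes the logarithm nonzero.\<close>
  moreover have "ln ((3 + sqrt 5) / 8) \<noteq> (0 :: real)"
    using r by (simp add: add_pos_nonneg)
  then have "(\<lambda>n. flow_entropy (path_graph n)) \<sim>[sequentially] (\<lambda>n. ln ((3 + sqrt 5) / 8))"
    using flow_entropy_path_graph_tendsto by (simp add: tendsto_imp_asymp_equiv_const)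
  ultimately show ?thesis
    by (simp only: F Let_def simp_thms)
qed

end
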